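(* Let $R$ be a valuation domain and $\{*_\alpha\}_{\alpha\in A}$ a (nonempty) set of semistar operations on $R$. Then the following are equivalent. (1) $*_A$ is of finite type. (2) $\bigcap_{\alpha\in A}\mathcal{F}^{*_\alpha}$ is of finite type. (3) There exists $\alpha\in A$ such that $I^{*_A}=IR^{*_\alpha}$ for each $I\in\overline{F}(R)$.
   Context: $R$ has quotient field $K$; $\overline{F}(R)$ is the set of nonzero $R$-submodules of $K$. Semistar operation: a map $*:\overline{F}(R)\to\overline{F}(R)$, $I\mapsto I^*$, such that for all $I,J\in\overline{F}(R)$ and $x\in K\setminus\{0\}$: $I\subseteq I^*$; $I\subseteq J$ implies $I^*\subseteq J^*$; $(xI)^*=xI^*$; $(I^* )^*=I^*$. It is of finite type if $I^*=\bigcup\{J^*\mid J\subseteq I,\ J\text{ a nonzero finitely generated }R\text{-submodule of }K\}$ for all $I\in\overline{F}(R)$. The semistar operation $*_A$ is defined by $I^{*_A}=\bigcap_{\alpha\in A}I^{*_\alpha}$ for $I\in\overline{F}(R)$. For a semistar operation $*$, $\mathcal{F}^*$ is the set of (nonzero) ideals $I$ of $R$ with $I^*=R^*$; it is a localizing system. A localizing system $\mathcal{F}$ of $R$ is a nonempty family of ideals such that (LS1) if $I\in\mathcal{F}$ and $J\supseteq I$ is an ideal of $R$ then $J\in\mathcal{F}$; (LS2) if $I\in\mathcal{F}$ and $J$ is an ideal of $R$ with $(J:_Ri)=\{r\in R\mid ri\in J\}\in\mathcal{F}$ for all $i\in I$, then $J\in\mathcal{F}$. It is of finite type if every $I\in\mathcal{F}$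 contains a finitely generated ideal $J$ with $J\in\mathcal{F}$. *)

theory Defs
  imports Complex_Main "HOL-Computational_Algebra.Polynomial_Factorial"
begin

text \<open>
  The domain R is the type \<open>'a\<close>, its quotient field K is \<open>'a fract\<close>, and R is
  embedded in K by \<open>to_fract\<close>.
\<close>

definition valuation_domain :: "'a::idom itself \<Rightarrow> bool"
  where "valuation_domain (_ :: 'a itself) \<longleftrightarrow>
    (\<forall>x :: 'a fract. x \<noteq> 0 \<longrightarrow> x \<in> range to_fract \<or> inverse x \<in> range to_fract)"

definition scaleK :: "'a::idom \<Rightarrow> 'a fract \<Rightarrow> 'a fract"
  where "scaleK r x = to_fract r * x"

text \<open>
  \<open>K_mod.subspace\<close> and \<open>K_mod.span\<close> are the R-submodules of K and the R-submodule
  generated by a subset of K; \<open>R_mod.subspace\<close> and \<open>R_mod.span\<close> are the ideals of R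
  and the ideal generated by a subset of R.
\<close>

global_interpretation K_mod: module "scaleK :: 'a::idom \<Rightarrow> 'a fract \<Rightarrow> 'a fract"
  by unfold_locales
    (simp_all add: scaleK_def algebra_simps)

global_interpretation R_mod: module "(*) :: 'a::idom \<Rightarrow> 'a \<Rightarrow> 'a"
  by unfold_locales (simp_all add: algebra_simps)

definition Fbar :: "'a::idom fract set set"
  where "Fbar = {M. K_mod.subspace M \<and> M \<noteq> {0}}"

definition mod_prod :: "'a::idom fract set \<Rightarrow> 'a fract set \<Rightarrow> 'a fract set"
  where "mod_prod M N = K_mod.span {x * y | x y. x \<in> M \<and> y \<in> N}"

text \<open>Only the values of a semistar operation on \<open>Fbar\<close> are meaningful.\<close>

definition semistar :: "('a::idom fract set \<Rightarrow> 'a fract set) \<Rightarrow> bool"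
  where "semistar st \<longleftrightarrow>
    (\<forall>I\<in>Fbar. st I \<in> Fbar) \<and>
    (\<forall>I\<in>Fbar. I \<subseteq> st I) \<and>
    (\<forall>I\<in>Fbar. \<forall>J\<in>Fbar. I \<subseteq> J \<longrightarrow> st I \<subseteq> st J) \<and>
    (\<forall>I\<in>Fbar. \<forall>x. x \<noteq> 0 \<longrightarrow> st ((*) x ` I) = (*) x ` st I) \<and>
    (\<forall>I\<in>Fbar. st (st I) = st I)"

definition semistar_finite_type :: "('a::idom fract set \<Rightarrow> 'a fract set) \<Rightarrow> bool"
  where "semistar_finite_type st \<longleftrightarrow> semistar st \<and>
    (\<forall>I\<in>Fbar. st I = \<Union>{st J | J. J \<in> Fbar \<and> J \<subseteq> I \<and> (\<exists>S. finite S \<and> J = K_mod.span S)})"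

definition semistar_Inter ::
    "'i set \<Rightarrow> ('i \<Rightarrow> 'a::idom fract set \<Rightarrow> 'a fract set) \<Rightarrow> 'a fract set \<Rightarrow> 'a fract set"
  where "semistar_Inter A st I = (\<Inter>\<alpha>\<in>A. st \<alpha> I)"

definition localizing_system :: "'a::idom set set \<Rightarrow> bool"
  where "localizing_system F \<longleftrightarrow>
    F \<noteq> {} \<and>
    (\<forall>I\<in>F. R_mod.subspace I) \<and>
    (\<forall>I\<in>F. \<forall>J. R_mod.subspace J \<and> I \<subseteq> J \<longrightarrow> J \<in> F) \<and>
    (\<forall>I\<in>F. \<forall>J. R_mod.subspace J \<and> (\<forall>i\<in>I. {r. r * i \<in> J} \<in> F) \<longrightarrow> J \<in> F)"

definition localizing_system_finite_type :: "'a::idom set set \<Rightarrow> bool"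
  where "localizing_system_finite_type F \<longleftrightarrow> localizing_system F \<and>
    (\<forall>I\<in>F. \<exists>J\<in>F. J \<subseteq> I \<and> (\<exists>S. finite S \<and> J = R_mod.span S))"

definition loc_system_of :: "('a::idom fract set \<Rightarrow> 'a fract set) \<Rightarrow> 'a set set"
  where "loc_system_of st =
    {I. R_mod.subspace I \<and> I \<noteq> {0} \<and> st (to_fract ` I) = st (range to_fract)}"

end

theory Submission
  imports Defs
begin

text \<open>
  The implication from (2) to (3) is the substantial one. Put \<open>V = R\<^bsup>*\<^sub>A\<^esup>\<close>, a valuation overring
  of R with maximal ideal \<open>P \<subseteq> R\<close>. Finitely generated ideals of R being principal, an ideal of
  the intersected system contains, by (2), an element invertible in every \<open>R\<^bsup>*\<^sub>\<alpha>\<^esup>\<close>, hence in \<open>V\<close>;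
  so P is not in the system, and \<open>1 \<notin> P\<^bsup>*\<^sub>\<alpha>\<^esup>\<close> for some \<open>\<alpha>\<close>. This forces \<open>R\<^bsup>*\<^sub>\<alpha>\<^esup> = V\<close> and
  \<open>P\<^bsup>*\<^sub>\<alpha>\<^esup> = P\<close>. If \<open>x \<notin> IV\<close> then \<open>I \<subseteq> xP\<close>, whence \<open>I\<^bsup>*\<^sub>\<alpha>\<^esup> \<subseteq> xP\<close> does not contain x.
\<close>

section \<open>Submodules of the quotient field and their products\<close>

lemma Fbar_iff:
  "M \<in> Fbar \<longleftrightarrow> 0 \<in> M \<and> (\<forall>x\<in>M. \<forall>y\<in>M. x + y \<in> M) \<and> (\<forall>r. \<forall>x\<in>M. to_fract r * x \<in> M) \<and> M \<noteq> {0}"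
  by (auto simp: Fbar_def K_mod.subspace_def scaleK_def)

lemma FbarD:
  assumes "M \<in> Fbar"
  shows "0 \<in> M" "\<And>x y. x \<in> M \<Longrightarrow> y \<in> M \<Longrightarrow> x + y \<in> M" "\<And>r x. x \<in> M \<Longrightarrow> to_fract r * x \<in> M"
  using assms by (auto simp: Fbar_iff)

lemma Fbar_nonzero:
  assumes "M \<in> Fbar"
  obtains x where "x \<in> M" "x \<noteq> 0"
  using assms by (auto simp: Fbar_iff)

lemma image_to_fract_in_Fbar:
  assumes "R_mod.subspace I" "I \<noteq> {0}"
  shows "to_fract ` I \<in> Fbar"
proof -
  have I: "0 \<in> I" "\<And>x y. x \<in> I \<Longrightarrow> y \<in> I \<Longrightarrow> x + y \<in> I" "\<And>r x. x \<in> I \<Longrightarrow> r * x \<in> I"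
    using assms(1) by (auto simp: R_mod.subspace_def)
  obtain x where "x \<in> I" "x \<noteq> 0" using I(1) assms(2) by auto
  then have "to_fract ` I \<noteq> {0}" by (metis image_eqI singletonD to_fract_eq_0_iff)
  with I show ?thesis
    by (auto simp: Fbar_iff simp flip: to_fract_add to_fract_mult to_fract_0)
qed

lemma range_to_fract_in_Fbar: "range to_fract \<in> (Fbar :: 'a::idom fract set set)"
  by (rule image_to_fract_in_Fbar) (auto, metis UNIV_I singletonD zero_neq_one)

lemma one_in_range_to_fract: "1 \<in> range to_fract"
  by (metis rangeI to_fract_1)

lemma scaled_in_Fbar:
  assumes "M \<in> Fbar" "x \<noteq> 0"
  shows "(*) x ` M \<in> Fbar"
proof -
  obtain y where "y \<in> M" "y \<noteq> 0" using assms(1) by (rule Fbar_nonzero)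
  then have "x * y \<in> (*) x ` M" "x * y \<noteq> 0" using assms(2) by auto
  then have "(*) x ` M \<noteq> {0}" by blast
  moreover have "x * a + x * b \<in> (*) x ` M" if "a \<in> M" "b \<in> M" for a b
    using FbarD(2)[OF assms(1) that] by (auto simp flip: distrib_left)
  moreover have "to_fract r * (x * a) \<in> (*) x ` M" if "a \<in> M" for a r
    using FbarD(3)[OF assms(1) that, of r] by (auto simp: mult.left_commute)
  ultimately show ?thesis
    using FbarD(1)[OF assms(1)] by (auto simp: Fbar_iff)
qed

lemma span_in_Fbar:
  assumes "x \<in> S" "x \<noteq> 0"
  shows "K_mod.span S \<in> Fbar"
  using assms K_mod.span_base[of x S] by (auto simp: Fbar_def)

lemma mod_prod_subset:
  assumes "L \<in> Fbar" "\<And>x y. x \<in> M \<Longrightarrow> y \<in> N \<Longrightarrow> x * y \<in> L"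
  shows "mod_prod M N \<subseteq> L"
  unfolding mod_prod_def using assms by (intro K_mod.span_minimal) (auto simp: Fbar_def)

lemma mult_in_mod_prod: "x \<in> M \<Longrightarrow> y \<in> N \<Longrightarrow> x * y \<in> mod_prod M N"
  unfolding mod_prod_def by (intro K_mod.span_base) auto

lemma mod_prod_in_Fbar:
  assumes "M \<in> Fbar" "N \<in> Fbar"
  shows "mod_prod M N \<in> Fbar"
proof -
  obtain x where "x \<in> M" "x \<noteq> 0" using assms(1) by (rule Fbar_nonzero)
  moreover obtain y where "y \<in> N" "y \<noteq> 0" using assms(2) by (rule Fbar_nonzero)
  ultimately show ?thesis
    unfolding mod_prod_def by (intro span_in_Fbar[of "x * y"]) auto
qed

text \<open>An element of the product is a finite combination of products, so it involves only
  finitely many elements of \<open>M\<close>. This is what makes extension to an overring an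
  operation of finite type.\<close>

lemma mod_prod_finitely_generated:
  assumes "M \<in> Fbar" "z \<in> mod_prod M N"
  obtains S where "finite S" "S \<subseteq> M" "K_mod.span S \<in> Fbar" "z \<in> mod_prod (K_mod.span S) N"
proof -
  \<comment> \<open>For \<open>z = 0\<close> the induction can return the empty set, whose span {0}
    is not in \<open>Fbar\<close>; adjoining \<open>m\<close> to the generators at the end repairs
    this.\<close>
  obtain m where m: "m \<in> M" "m \<noteq> 0" using assms(1) by (rule Fbar_nonzero)
  have "\<exists>S. finite S \<and> S \<subseteq> M \<and> z \<in> mod_prod (K_mod.span S) N"
    using assms(2) unfolding mod_prod_def[of M]
  proof (induction rule: K_mod.span_induct_alt)
    case base
    show ?case by (rule exI[of _ "{}"]) (auto simp: mod_prod_def K_mod.span_zero)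
  next
    case (step c b y)
    obtain x n where b: "b = x * n" "x \<in> M" "n \<in> N" using step(1) by auto
    obtain S where S: "finite S" "S \<subseteq> M" "y \<in> mod_prod (K_mod.span S) N" using step(2) by auto
    have "mod_prod (K_mod.span S) N \<subseteq> mod_prod (K_mod.span (insert x S)) N"
      unfolding mod_prod_def
      by (intro K_mod.span_mono) (use K_mod.span_mono[of S "insert x S"] in blast)
    moreover have "b \<in> mod_prod (K_mod.span (insert x S)) N"
      unfolding b(1) using b(3) by (intro mult_in_mod_prod K_mod.span_base) auto
    ultimately have "scaleK c b + y \<in> mod_prod (K_mod.span (insert x S)) N"
      using S(3) unfolding mod_prod_def by (intro K_mod.span_add K_mod.span_scale) auto
    with S(1,2) b(2) show ?case by (intro exI[of _ "insert x S"]) auto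
  qed
  then obtain S where S: "finite S" "S \<subseteq> M" "z \<in> mod_prod (K_mod.span S) N" by blast
  have "mod_prod (K_mod.span S) N \<subseteq> mod_prod (K_mod.span (insert m S)) N"
    unfolding mod_prod_def
    by (intro K_mod.span_mono) (use K_mod.span_mono[of S "insert m S"] in blast)
  with S m show thesis
    by (intro that[of "insert m S"]) (auto intro: span_in_Fbar[of m])
qed

section \<open>Semistar operations and their localizing systems\<close>

lemma semistarD:
  assumes "semistar st" "I \<in> Fbar"
  shows "st I \<in> Fbar" "I \<subseteq> st I" "\<And>J. J \<in> Fbar \<Longrightarrow> I \<subseteq> J \<Longrightarrow> st I \<subseteq> st J"
    "\<And>x. x \<noteq> 0 \<Longrightarrow> st ((*) x ` I) = (*) x ` st I" "st (st I) = st I"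
  using assms by (simp_all add: semistar_def)

text \<open>Multiplication by a nonzero \<open>x\<close> carries R into \<open>st I\<close>, hence
  the closure of R into \<open>st (st I) = st I\<close>. For \<open>I = R\<close> this makes the
  closure of R a ring; in general it makes \<open>st I\<close> a module over that ring.\<close>

lemma semistar_mult_closed:
  assumes "semistar st" "I \<in> Fbar" "x \<in> st I" "v \<in> st (range to_fract)"
  shows "x * v \<in> st I"
proof (cases "x = 0")
  case True
  then show ?thesis using semistarD(1)[OF assms(1,2)] FbarD(1) by auto
next
  case False
  have sub: "(*) x ` range to_fract \<subseteq> st I"
    using FbarD(3)[OF semistarD(1)[OF assms(1,2)] assms(3)] by (auto simp: mult.commute)
  have "x * v \<in> st ((*) x ` range to_fract)"
    using semistarD(4)[OF assms(1) range_to_fract_in_Fbar False] assms(4) by auto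
  also have "\<dots> \<subseteq> st (st I)"
    using semistarD(3)[OF assms(1) scaled_in_Fbar[OF range_to_fract_in_Fbar False]
        semistarD(1)[OF assms(1,2)] sub] .
  finally show ?thesis using semistarD(5)[OF assms(1,2)] by simp
qed

text \<open>As \<open>st I\<close> is a module over the closure of R, it contains that closure as
  soon as it contains 1. Testing a single element is what makes the system easy to compare across
  intersections.\<close>

lemma in_loc_system_of_iff:
  assumes "semistar st"
  shows "I \<in> loc_system_of st \<longleftrightarrow> R_mod.subspace I \<and> I \<noteq> {0} \<and> 1 \<in> st (to_fract ` I)"
proof -
  have "st (to_fract ` I) = st (range to_fract) \<longleftrightarrow> 1 \<in> st (to_fract ` I)"
    if I: "R_mod.subspace I" "I \<noteq> {0}"
  proof
    have "1 \<in> st (range to_fract)"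
      using semistarD(2)[OF assms range_to_fract_in_Fbar] one_in_range_to_fract by blast
    then show "1 \<in> st (to_fract ` I)" if "st (to_fract ` I) = st (range to_fract)"
      using that by simp
  next
    assume one: "1 \<in> st (to_fract ` I)"
    have "st (to_fract ` I) \<subseteq> st (range to_fract)"
      using semistarD(3)[OF assms image_to_fract_in_Fbar[OF I] range_to_fract_in_Fbar] by blast
    with semistar_mult_closed[OF assms image_to_fract_in_Fbar[OF I] one]
    show "st (to_fract ` I) = st (range to_fract)" by auto
  qed
  then show ?thesis unfolding loc_system_of_def by blast
qed

lemma semistar_semistar_Inter:
  assumes "A \<noteq> {}" "\<And>\<alpha>. \<alpha> \<in> A \<Longrightarrow> semistar (st \<alpha>)"
  shows "semistar (semistar_Inter A st)"
proof -
  have Fbar: "semistar_Inter A st I \<in> Fbar" and ext: "I \<subseteq> semistar_Inter A st I"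
    if I: "I \<in> Fbar" for I
  proof -
    show "I \<subseteq> semistar_Inter A st I"
      using semistarD(2)[OF assms(2) I] by (auto simp: semistar_Inter_def)
    moreover obtain x where "x \<in> I" "x \<noteq> 0" using I by (rule Fbar_nonzero)
    ultimately have "semistar_Inter A st I \<noteq> {0}" by blast
    moreover have "K_mod.subspace (st \<alpha> I)" if "\<alpha> \<in> A" for \<alpha>
      using semistarD(1)[OF assms(2)[OF that] I] by (simp add: Fbar_def)
    then have "K_mod.subspace (semistar_Inter A st I)"
      unfolding semistar_Inter_def K_mod.subspace_def by simp
    ultimately show "semistar_Inter A st I \<in> Fbar" by (simp add: Fbar_def)
  qed
  have mono: "semistar_Inter A st I \<subseteq> semistar_Inter A st J"
    if "I \<in> Fbar" "J \<in> Fbar" "I \<subseteq> J" for I J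
    using semistarD(3)[OF assms(2) that] by (fastforce simp: semistar_Inter_def)
  have scale: "semistar_Inter A st ((*) x ` I) = (*) x ` semistar_Inter A st I"
    if "I \<in> Fbar" "x \<noteq> 0" for I x
  proof -
    \<comment> \<open>The index \<open>\<beta>\<close> shows that the intersection is
      nonempty-indexed, so that the injective map \<open>x * _\<close> commutes with it.\<close>
    obtain \<beta> where \<beta>: "\<beta> \<in> A" using assms(1) by blast
    have inj: "inj ((*) x)" using that(2) by (auto intro: injI)
    have "semistar_Inter A st ((*) x ` I) = (\<Inter>\<alpha>\<in>A. (*) x ` st \<alpha> I)"
      unfolding semistar_Inter_def using semistarD(4)[OF assms(2) that] by (rule INF_cong[OF refl])
    also have "\<dots> = (*) x ` semistar_Inter A st I"
      unfolding semistar_Inter_def by (rule image_INT[symmetric, OF inj _ \<beta>]) simp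
    finally show ?thesis .
  qed
  \<comment> \<open>Idempotence comes from each component: the intersection lies in
    \<open>st \<alpha> I\<close>, to which \<open>st \<alpha>\<close> adds nothing.\<close>
  have "semistar_Inter A st (semistar_Inter A st I) \<subseteq> semistar_Inter A st I"
    if I: "I \<in> Fbar" for I
  proof
    fix x assume x: "x \<in> semistar_Inter A st (semistar_Inter A st I)"
    have "x \<in> st \<alpha> I" if \<alpha>: "\<alpha> \<in> A" for \<alpha>
    proof -
      have "semistar_Inter A st I \<subseteq> st \<alpha> I" using \<alpha> by (auto simp: semistar_Inter_def)
      from semistarD(3)[OF assms(2)[OF \<alpha>] Fbar[OF I] semistarD(1)[OF assms(2)[OF \<alpha>] I] this]
      show ?thesis
        using x \<alpha> semistarD(5)[OF assms(2)[OF \<alpha>] I] by (auto simp: semistar_Inter_def)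
    qed
    then show "x \<in> semistar_Inter A st I" by (simp add: semistar_Inter_def)
  qed
  with Fbar ext mono scale show ?thesis
    unfolding semistar_def by (meson subset_antisym)
qed

text \<open>The element 1 lies in an intersection exactly when it lies in every member. Condition
  (2) thereby becomes a statement about the single operation
  \<open>semistar_Inter A st\<close>.\<close>

lemma Inter_loc_system_of:
  assumes "A \<noteq> {}" "\<And>\<alpha>. \<alpha> \<in> A \<Longrightarrow> semistar (st \<alpha>)"
  shows "(\<Inter>\<alpha>\<in>A. loc_system_of (st \<alpha>)) = loc_system_of (semistar_Inter A st)"
  using assms(1) in_loc_system_of_iff[OF assms(2)]
    in_loc_system_of_iff[OF semistar_semistar_Inter[OF assms]]
  by (auto simp: semistar_Inter_def)

lemma localizing_system_loc_system_of:
  fixes st :: "'a::idom fract set \<Rightarrow> 'a fract set"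
  assumes "semistar st"
  shows "localizing_system (loc_system_of st)"
proof -
  note mem = in_loc_system_of_iff[OF assms]
  have "UNIV \<noteq> {0 :: 'a}" by (metis UNIV_I singletonD zero_neq_one)
  then have "UNIV \<in> loc_system_of st"
    using semistarD(2)[OF assms range_to_fract_in_Fbar] one_in_range_to_fract
    unfolding mem by auto
  moreover have "J \<in> loc_system_of st"
    if I: "I \<in> loc_system_of st" and J: "R_mod.subspace J" "I \<subseteq> J" for I J
  proof -
    have I': "R_mod.subspace I" "I \<noteq> {0}" "1 \<in> st (to_fract ` I)" using I by (auto simp: mem)
    have "J \<noteq> {0}" using I'(1,2) J(2) R_mod.subspace_0 by auto
    with semistarD(3)[OF assms image_to_fract_in_Fbar[OF I'(1,2)] image_to_fract_in_Fbar[OF J(1)]]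
      I'(3) J show ?thesis by (auto simp: mem)
  qed
  moreover have "J \<in> loc_system_of st"
    if I: "I \<in> loc_system_of st" and J: "R_mod.subspace J"
      and colon: "\<And>i. i \<in> I \<Longrightarrow> {r. r * i \<in> J} \<in> loc_system_of st" for I J
  proof -
    have I': "R_mod.subspace I" "I \<noteq> {0}" "1 \<in> st (to_fract ` I)" using I by (auto simp: mem)
    \<comment> \<open>The system holds nonzero ideals only, so \<open>J\<close> must be shown
      nonzero: it contains \<open>r * i0\<close> for a nonzero \<open>r\<close> of the colon
      ideal.\<close>
    obtain i0 where i0: "i0 \<in> I" "i0 \<noteq> 0" using I'(1,2) R_mod.subspace_0 by auto
    have "{r. r * i0 \<in> J} \<noteq> {0}" using colon[OF i0(1)] by (auto simp: mem)
    then obtain r where "r * i0 \<in> J" "r \<noteq> 0" using R_mod.subspace_0[OF J] by force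
    then have "J \<noteq> {0}" using i0(2) by auto
    note JF = image_to_fract_in_Fbar[OF J this]
    \<comment> \<open>With C the colon ideal of \<open>i\<close>, \<open>i C\<close> lies in
      \<open>J\<close> and 1 lies in \<open>st C\<close>, so \<open>i\<close> lies in
      \<open>i (st C) = st (i C)\<close>, inside \<open>st J\<close>. Then \<open>I\<close> lies in
      \<open>st J\<close>, and idempotence moves 1 from \<open>st I\<close> to
      \<open>st J\<close>.\<close>
    have "to_fract i \<in> st (to_fract ` J)" if i: "i \<in> I" for i
    proof (cases "i = 0")
      case True
      then show ?thesis using FbarD(1)[OF semistarD(1)[OF assms JF]] by simp
    next
      case False
      let ?C = "{r. r * i \<in> J}"
      have C: "to_fract ` ?C \<in> Fbar" "1 \<in> st (to_fract ` ?C)"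
        using colon[OF i] image_to_fract_in_Fbar[of ?C] by (auto simp: mem)
      have nz: "to_fract i \<noteq> 0" using False by simp
      have "(*) (to_fract i) ` to_fract ` ?C \<subseteq> to_fract ` J"
        by (auto simp: mult.commute simp flip: to_fract_mult)
      from semistarD(3)[OF assms scaled_in_Fbar[OF C(1) nz] JF this]
      have "(*) (to_fract i) ` st (to_fract ` ?C) \<subseteq> st (to_fract ` J)"
        using semistarD(4)[OF assms C(1) nz] by simp
      with C(2) show ?thesis by force
    qed
    then have "st (to_fract ` I) \<subseteq> st (st (to_fract ` J))"
      by (intro semistarD(3)[OF assms image_to_fract_in_Fbar[OF I'(1,2)] semistarD(1)[OF assms JF]])
        auto
    with I'(3) \<open>J \<noteq> {0}\<close> J show ?thesis
      using semistarD(5)[OF assms JF] by (auto simp: mem)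
  qed
  moreover have "R_mod.subspace I" if "I \<in> loc_system_of st" for I
    using that by (simp add: mem)
  ultimately show ?thesis
    unfolding localizing_system_def by (intro conjI ballI allI impI) blast+
qed

section \<open>Finite type of semistar operations, localizing systems and extensions\<close>

lemma K_span_image_to_fract: "K_mod.span (to_fract ` S) = to_fract ` R_mod.span S"
proof
  have "K_mod.subspace (to_fract ` R_mod.span S)"
    using R_mod.subspace_span[of S]
    by (auto simp: K_mod.subspace_def R_mod.subspace_def scaleK_def
        simp flip: to_fract_add to_fract_mult to_fract_0)
  then show "K_mod.span (to_fract ` S) \<subseteq> to_fract ` R_mod.span S"
    by (rule K_mod.span_minimal[rotated]) (auto intro: R_mod.span_base)
  have "to_fract x \<in> K_mod.span (to_fract ` S)" if "x \<in> R_mod.span S" for x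
    using that
  proof (induction rule: R_mod.span_induct_alt)
    case base
    then show ?case by (simp add: K_mod.span_zero)
  next
    case (step c x y)
    then have "scaleK c (to_fract x) + to_fract y \<in> K_mod.span (to_fract ` S)"
      by (intro K_mod.span_add K_mod.span_scale) (auto intro: K_mod.span_base)
    moreover have "scaleK c (to_fract x) + to_fract y = to_fract (c * x + y)"
      by (simp add: scaleK_def)
    ultimately show ?case by simp
  qed
  then show "to_fract ` R_mod.span S \<subseteq> K_mod.span (to_fract ` S)" by blast
qed

text \<open>This is (1) to (2): finite type places 1 in the closure of a finitely generated
  submodule of \<open>I\<close>, whose generators come from R.\<close>

lemma finite_type_loc_system_of:
  assumes "semistar_finite_type st"
  shows "localizing_system_finite_type (loc_system_of st)"
proof -
  have st: "semistar st" using assms by (simp add: semistar_finite_type_def)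
  note mem = in_loc_system_of_iff[OF st]
  have "\<exists>J\<in>loc_system_of st. J \<subseteq> I \<and> (\<exists>S. finite S \<and> J = R_mod.span S)"
    if "I \<in> loc_system_of st" for I
  proof -
    have I: "R_mod.subspace I" "I \<noteq> {0}" "1 \<in> st (to_fract ` I)" using that by (auto simp: mem)
    obtain S where S: "1 \<in> st (K_mod.span S)" "K_mod.span S \<in> Fbar"
        "K_mod.span S \<subseteq> to_fract ` I" "finite S"
      using assms I(3) image_to_fract_in_Fbar[OF I(1,2)]
      unfolding semistar_finite_type_def by blast
    have "S \<subseteq> to_fract ` I" using S(3) K_mod.span_superset by blast
    then obtain T where T: "finite T" "T \<subseteq> I" "S = to_fract ` T"
      using S(4) finite_subset_image by metis
    have span: "K_mod.span S = to_fract ` R_mod.span T"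
      unfolding T(3) by (rule K_span_image_to_fract)
    have "R_mod.span T \<noteq> {0}" using S(2) span by (auto simp: Fbar_iff)
    then have "R_mod.span T \<in> loc_system_of st" using S(1) span by (simp add: mem)
    with T(1) R_mod.span_minimal[OF T(2) I(1)] show ?thesis by blast
  qed
  with localizing_system_loc_system_of[OF st] show ?thesis
    by (auto simp: localizing_system_finite_type_def)
qed

text \<open>This is (3) to (1): each element of the product of \<open>I\<close> with
  \<open>N\<close> already arises from a finitely generated part of \<open>I\<close>.\<close>

lemma semistar_finite_type_extension:
  assumes "semistar st" "N \<in> Fbar" "\<And>I. I \<in> Fbar \<Longrightarrow> st I = mod_prod I N"
  shows "semistar_finite_type st"
proof -
  have "st I = \<Union>{st J | J. J \<in> Fbar \<and> J \<subseteq> I \<and> (\<exists>S. finite S \<and> J = K_mod.span S)}" (is "_ = ?U")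
    if I: "I \<in> Fbar" for I
  proof
    show "?U \<subseteq> st I" using semistarD(3)[OF assms(1) _ I] by blast
    show "st I \<subseteq> ?U"
    proof
      fix z assume "z \<in> st I"
      then have "z \<in> mod_prod I N" using assms(3)[OF I] by simp
      with I obtain S where S: "finite S" "S \<subseteq> I" "K_mod.span S \<in> Fbar"
          "z \<in> mod_prod (K_mod.span S) N"
        by (rule mod_prod_finitely_generated)
      have "K_mod.span S \<subseteq> I" using I S(2) by (intro K_mod.span_minimal) (auto simp: Fbar_def)
      with S show "z \<in> ?U" using assms(3)[OF S(3)] by blast
    qed
  qed
  with assms(1) show ?thesis by (simp add: semistar_finite_type_def)
qed

section \<open>Valuation domains\<close>

lemma valuation_domainD:
  fixes x :: "'a::idom fract"
  assumes "valuation_domain TYPE('a)" "x \<notin> range to_fract"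
  shows "inverse x \<in> range to_fract"
  using assms unfolding valuation_domain_def by (metis image_eqI UNIV_I to_fract_0)

lemma valuation_domain_dvd_linear:
  fixes a b :: "'a::idom"
  assumes "valuation_domain TYPE('a)"
  shows "a dvd b \<or> b dvd a"
proof (cases "a = 0 \<or> b = 0")
  case False
  have dvdI: "c dvd d" if "to_fract d / to_fract c \<in> range to_fract" "c \<noteq> 0" for c d :: 'a
  proof -
    from that obtain r where "to_fract d = to_fract (c * r)"
      by (auto simp: field_simps)
    then show ?thesis unfolding to_fract_eq_iff by simp
  qed
  show ?thesis
    using valuation_domainD[OF assms, of "to_fract b / to_fract a"] dvdI[of b a] dvdI[of a b] False
    by auto
qed auto

lemma finitely_generated_ideal_principal:
  fixes S :: "'a::idom set"
  assumes "valuation_domain TYPE('a)" "finite S"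
  shows "\<exists>a. R_mod.span S = range ((*) a)"
proof -
  \<comment> \<open>Divisibility is a total preorder, so some generator divides all the others.
    Asking for \<open>a\<close> in the span instead of in \<open>S\<close> covers the empty set,
    with \<open>a = 0\<close>.\<close>
  have "\<exists>a\<in>R_mod.span S. \<forall>s\<in>S. a dvd s"
    using assms(2)
  proof (induction S)
    case empty
    then show ?case by (auto intro: R_mod.span_zero)
  next
    case (insert x S)
    then obtain a where a: "a \<in> R_mod.span S" "\<forall>s\<in>S. a dvd s" by blast
    show ?case
    proof (cases "a dvd x")
      case True
      with a R_mod.span_mono[of S "insert x S"] show ?thesis by blast
    next
      case False
      then have "x dvd a" using valuation_domain_dvd_linear[OF assms(1)] by blast
      with a(2) show ?thesis
        by (intro bexI[of _ x] R_mod.span_base) (auto intro: dvd_trans)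
    qed
  qed
  then obtain a where a: "a \<in> R_mod.span S" "\<forall>s\<in>S. a dvd s" by blast
  have "R_mod.subspace {x. a dvd x}" by (auto simp: R_mod.subspace_def)
  with a(2) have "R_mod.span S \<subseteq> {x. a dvd x}" by (intro R_mod.span_minimal) auto
  then have "R_mod.span S \<subseteq> range ((*) a)" by (auto simp: dvd_def)
  moreover have "range ((*) a) \<subseteq> R_mod.span S"
    using R_mod.span_scale[OF a(1)] by (auto simp: mult.commute)
  ultimately show ?thesis by blast
qed

text \<open>
  The maximal ideal of a valuation overring V. With \<open>inverse 0 = 0 \<in> V\<close>, the clause for 0 is needed.
\<close>

definition nonunits :: "'a::idom fract set \<Rightarrow> 'a fract set"
  where "nonunits V = {x. x = 0 \<or> inverse x \<notin> V}"

context
  fixes V :: "'a::idom fract set"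
  assumes valuation: "valuation_domain TYPE('a)"
    and overring: "range to_fract \<subseteq> V" "\<forall>x\<in>V. \<forall>y\<in>V. x * y \<in> V"
begin

text \<open>An element outside R has its inverse in R, hence in \<open>V\<close>. So the maximal
  ideal of \<open>V\<close> is also a subset of R and can be tested for membership in a localizing
  system.\<close>

lemma nonunits_subset: "nonunits V \<subseteq> range to_fract"
proof
  fix x assume x: "x \<in> nonunits V"
  show "x \<in> range to_fract"
  proof (rule ccontr)
    assume n: "x \<notin> range to_fract"
    then have "x \<noteq> 0" by (metis rangeI to_fract_0)
    with valuation_domainD[OF valuation n] x overring(1) show False
      by (auto simp: nonunits_def)
  qed
qed

lemma nonunits_mult:
  assumes "x \<in> nonunits V" "v \<in> V"
  shows "v * x \<in> nonunits V"
proof (cases "v * x = 0")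
  case False
  have "inverse (v * x) \<notin> V"
  proof
    assume "inverse (v * x) \<in> V"
    then have "v * inverse (v * x) \<in> V" using overring(2) assms(2) by blast
    also have "v * inverse (v * x) = inverse x" using False by simp
    finally show False using assms(1) False by (auto simp: nonunits_def)
  qed
  then show ?thesis by (auto simp: nonunits_def)
qed (auto simp: nonunits_def)

lemma nonunits_add:
  assumes "x \<in> nonunits V" "y \<in> nonunits V"
  shows "x + y \<in> nonunits V"
proof -
  \<comment> \<open>Write \<open>a + b = (a / b + 1) * b\<close>, where the first factor lies in R.
    By the valuation property this applies to one of the two orders of the summands.\<close>
  have *: "a + b \<in> nonunits V" if "b \<in> nonunits V" "a / b \<in> range to_fract" "b \<noteq> 0" for a b
  proof -
    have "a / b + 1 \<in> V"
      using that(2) overring(1) one_in_range_to_fract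
        FbarD(2)[OF range_to_fract_in_Fbar, of "a / b" 1] by blast
    from nonunits_mult[OF that(1) this] show ?thesis using that(3) by (simp add: distrib_right)
  qed
  show ?thesis
  proof (cases "x = 0 \<or> y = 0")
    case False
    then have "x / y \<in> range to_fract \<or> y / x \<in> range to_fract"
      using valuation_domainD[OF valuation, of "x / y"] by auto
    with *[of y x] *[of x y] assms False show ?thesis by (auto simp: add.commute)
  qed (use assms in auto)
qed

lemma subspace_nonunits: "R_mod.subspace (to_fract -` nonunits V)"
proof -
  have "to_fract r \<in> V" for r using overring(1) by blast
  then show ?thesis
    by (auto simp: R_mod.subspace_def intro: nonunits_add nonunits_mult) (simp add: nonunits_def)
qed

end

section \<open>When a semistar operation is an extension to a valuation overring\<close>

text \<open>The closure could exceed the extension only by adding 1 to the maximal ideal of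
  \<open>V\<close>. The condition \<open>P\<close> is restricted to a nonzero maximal ideal because
  {0} is outside \<open>Fbar\<close>, where \<open>st\<close> carries no meaning.\<close>

lemma semistar_eq_extension:
  fixes st :: "'a::idom fract set \<Rightarrow> 'a fract set"
  defines "V \<equiv> st (range to_fract)"
  assumes valuation: "valuation_domain TYPE('a)"
    and st: "semistar st"
    and P: "nonunits V \<noteq> {0} \<Longrightarrow> 1 \<notin> st (nonunits V)"
    and I: "I \<in> Fbar"
  shows "st I = mod_prod I V"
proof
  have overring: "range to_fract \<subseteq> V" "\<forall>x\<in>V. \<forall>y\<in>V. x * y \<in> V"
    unfolding V_def using semistarD(2)[OF st range_to_fract_in_Fbar]
      semistar_mult_closed[OF st range_to_fract_in_Fbar] by auto
  note I_closed = semistar_mult_closed[OF st I, folded V_def]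
  show "mod_prod I V \<subseteq> st I"
    by (rule mod_prod_subset[OF semistarD(1)[OF st I]])
      (use I_closed semistarD(2)[OF st I] in auto)
  show "st I \<subseteq> mod_prod I V"
  proof (rule subsetI, rule ccontr)
    fix x assume x: "x \<in> st I" "x \<notin> mod_prod I V"
    have "V \<in> Fbar" unfolding V_def by (rule semistarD(1)[OF st range_to_fract_in_Fbar])
    then have x0: "x \<noteq> 0" using x(2) FbarD(1)[OF mod_prod_in_Fbar[OF I]] by auto
    have sub: "I \<subseteq> (*) x ` nonunits V"
    proof
      fix y assume y: "y \<in> I"
      \<comment> \<open>Otherwise \<open>x / y\<close> lies in \<open>V\<close>, and
        \<open>x = y * (x / y)\<close> lies in the product.\<close>
      have "y / x \<in> nonunits V"
        using x mult_in_mod_prod[OF y, of "x / y" V] by (auto simp: nonunits_def)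
      then show "y \<in> (*) x ` nonunits V" using x0 by (intro image_eqI[of _ _ "y / x"]) auto
    qed
    obtain y where "y \<in> I" "y \<noteq> 0" using I by (rule Fbar_nonzero)
    then have nz: "nonunits V \<noteq> {0}" using sub by auto
    have eq: "to_fract ` to_fract -` nonunits V = nonunits V"
      using nonunits_subset[OF valuation overring] by auto
    have PF: "nonunits V \<in> Fbar"
      using image_to_fract_in_Fbar[OF subspace_nonunits[OF valuation overring]] eq nz
      by (metis image_empty image_insert to_fract_0)
    \<comment> \<open>Monotonicity and scaling put \<open>x\<close> in
      \<open>x * st (nonunits V)\<close>; cancelling \<open>x\<close> leaves 1 in
      \<open>st (nonunits V)\<close>.\<close>
    have "x \<in> (*) x ` st (nonunits V)"
      using x(1) semistarD(3)[OF st I scaled_in_Fbar[OF PF x0] sub] semistarD(4)[OF st PF x0]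
      by auto
    then show False using x0 P[OF nz] by auto
  qed
qed

text \<open>A finitely generated member of the system is some \<open>a R\<close>, and 1 in
  \<open>st (a R) = a (st R)\<close> makes \<open>a\<close> a unit of the closure of R, so
  \<open>a\<close> cannot be in the maximal ideal.\<close>

lemma nonunits_not_in_finite_type_loc_system:
  fixes st :: "'a::idom fract set \<Rightarrow> 'a fract set"
  assumes valuation: "valuation_domain TYPE('a)"
    and st: "semistar st"
    and ft: "localizing_system_finite_type (loc_system_of st)"
  shows "to_fract -` nonunits (st (range to_fract)) \<notin> loc_system_of st"
proof
  let ?V = "st (range to_fract)"
  assume "to_fract -` nonunits ?V \<in> loc_system_of st"
  with ft obtain S where S: "R_mod.span S \<in> loc_system_of st"
      "R_mod.span S \<subseteq> to_fract -` nonunits ?V" "finite S"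
    unfolding localizing_system_finite_type_def by blast
  obtain a where a: "R_mod.span S = range ((*) a)"
    using finitely_generated_ideal_principal[OF valuation S(3)] by blast
  have "a \<noteq> 0" "1 \<in> st (to_fract ` range ((*) a))"
    using S(1) a in_loc_system_of_iff[OF st] by auto
  moreover have "to_fract ` range ((*) a) = (*) (to_fract a) ` range to_fract"
    by (simp add: image_image)
  ultimately have "1 \<in> (*) (to_fract a) ` ?V"
    using semistarD(4)[OF st range_to_fract_in_Fbar, of "to_fract a"] by simp
  then have "inverse (to_fract a) \<in> ?V" using \<open>a \<noteq> 0\<close> by (auto simp: inverse_unique)
  moreover have "a \<in> R_mod.span S" unfolding a by (metis mult.right_neutral rangeI)
  ultimately show False using S(2) \<open>a \<noteq> 0\<close> by (auto simp: nonunits_def)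
qed

lemma semistar_Inter_eq_extension:
  fixes st :: "'i \<Rightarrow> 'a::idom fract set \<Rightarrow> 'a fract set"
  assumes valuation: "valuation_domain TYPE('a)"
    and A: "A \<noteq> {}" "\<And>\<alpha>. \<alpha> \<in> A \<Longrightarrow> semistar (st \<alpha>)"
    and ft: "localizing_system_finite_type (loc_system_of (semistar_Inter A st))"
  shows "\<exists>\<alpha>\<in>A. \<forall>I\<in>Fbar. semistar_Inter A st I = mod_prod I (st \<alpha> (range to_fract))"
proof -
  let ?stA = "semistar_Inter A st"
  have stA: "semistar ?stA" using A by (rule semistar_semistar_Inter)
  define V where "V = ?stA (range to_fract)"
  have overring: "range to_fract \<subseteq> V" "\<forall>x\<in>V. \<forall>y\<in>V. x * y \<in> V"
    unfolding V_def using semistarD(2)[OF stA range_to_fract_in_Fbar]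
      semistar_mult_closed[OF stA range_to_fract_in_Fbar] by auto
  have eq: "to_fract ` to_fract -` nonunits V = nonunits V"
    using nonunits_subset[OF valuation overring] by auto
  have vimage_nz: "to_fract -` nonunits V \<noteq> {0}" if "nonunits V \<noteq> {0}"
    using eq that by (metis image_empty image_insert to_fract_0)
  have not1: "1 \<notin> ?stA (nonunits V)" if "nonunits V \<noteq> {0}"
    using nonunits_not_in_finite_type_loc_system[OF valuation stA ft, folded V_def]
      subspace_nonunits[OF valuation overring] vimage_nz[OF that]
    unfolding in_loc_system_of_iff[OF stA] eq by blast
  have ext: "?stA I = mod_prod I V" if "I \<in> Fbar" for I
    using semistar_eq_extension[OF valuation stA not1[unfolded V_def] that] unfolding V_def .
  \<comment> \<open>The reverse inclusion holds for every index, \<open>V\<close> being the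
    intersection of these closures.\<close>
  have "\<exists>\<alpha>\<in>A. st \<alpha> (range to_fract) \<subseteq> V"
  proof (cases "nonunits V = {0}")
    case True
    \<comment> \<open>A zero maximal ideal means that \<open>V\<close> is all of K, so every index
      will do.\<close>
    have "x \<in> V" for x
    proof (cases "x = 0")
      case True
      then show ?thesis using overring(1) by (metis rangeI subsetD to_fract_0)
    next
      case False
      then have "inverse x \<notin> nonunits V" using \<open>nonunits V = {0}\<close> by auto
      with False show ?thesis by (auto simp: nonunits_def)
    qed
    with A(1) show ?thesis by blast
  next
    case False
    obtain \<alpha> where \<alpha>: "\<alpha> \<in> A" "1 \<notin> st \<alpha> (nonunits V)"
      using not1[OF False] by (auto simp: semistar_Inter_def)
    have PF: "nonunits V \<in> Fbar"
      using image_to_fract_in_Fbar[OF subspace_nonunits[OF valuation overring] vimage_nz[OF False]]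
        eq by simp
    \<comment> \<open>For \<open>x\<close> outside \<open>V\<close>, \<open>inverse x\<close> is in
      the maximal ideal, and multiplying it by \<open>x\<close> would bring 1 into
      \<open>st \<alpha> (nonunits V)\<close>.\<close>
    have "x \<in> V" if x: "x \<in> st \<alpha> (range to_fract)" for x
    proof (rule ccontr)
      assume n: "x \<notin> V"
      then have "x \<noteq> 0" using overring(1) by (metis rangeI subsetD to_fract_0)
      have "inverse x \<in> nonunits V" using n by (simp add: nonunits_def)
      then have "inverse x \<in> st \<alpha> (nonunits V)" using semistarD(2)[OF A(2)[OF \<alpha>(1)] PF] by blast
      from semistar_mult_closed[OF A(2)[OF \<alpha>(1)] PF this x] \<open>x \<noteq> 0\<close> \<alpha>(2) show False by simp
    qed
    with \<alpha>(1) show ?thesis by blast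
  qed
  then obtain \<alpha> where \<alpha>: "\<alpha> \<in> A" "st \<alpha> (range to_fract) \<subseteq> V" by blast
  then have "st \<alpha> (range to_fract) = V" by (auto simp: V_def semistar_Inter_def)
  with \<alpha>(1) ext show ?thesis by blast
qed

theorem theorem6:
  fixes st :: "'i \<Rightarrow> 'a::idom fract set \<Rightarrow> 'a fract set"
    and A :: "'i set"
  assumes "valuation_domain TYPE('a)"
    and "A \<noteq> {}"
    and "\<And>\<alpha>. \<alpha> \<in> A \<Longrightarrow> semistar (st \<alpha>)"
  shows "(semistar_finite_type (semistar_Inter A st)
            \<longleftrightarrow> localizing_system_finite_type (\<Inter>\<alpha>\<in>A. loc_system_of (st \<alpha>)))
       \<and> (localizing_system_finite_type (\<Inter>\<alpha>\<in>A. loc_system_of (st \<alpha>))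
            \<longleftrightarrow> (\<exists>\<alpha>\<in>A. \<forall>I\<in>Fbar. semistar_Inter A st I = mod_prod I (st \<alpha> (range to_fract))))"
proof -
  have stA: "semistar (semistar_Inter A st)"
    using assms(2,3) by (rule semistar_semistar_Inter)
  have loc: "(\<Inter>\<alpha>\<in>A. loc_system_of (st \<alpha>)) = loc_system_of (semistar_Inter A st)"
    using assms(2,3) by (rule Inter_loc_system_of)
  have "\<exists>\<alpha>\<in>A. \<forall>I\<in>Fbar. semistar_Inter A st I = mod_prod I (st \<alpha> (range to_fract))"
    if "localizing_system_finite_type (loc_system_of (semistar_Inter A st))"
    using assms that by (rule semistar_Inter_eq_extension)
  moreover have "semistar_finite_type (semistar_Inter A st)"
    if "\<alpha> \<in> A" "\<forall>I\<in>Fbar. semistar_Inter A st I = mod_prod I (st \<alpha> (range to_fract))" for \<alpha>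
    using semistar_finite_type_extension[OF stA
        semistarD(1)[OF assms(3)[OF that(1)] range_to_fract_in_Fbar]] that(2) by blast
  \<comment> \<open>The cycle (2) to (3), (3) to (1), (1) to (2) yields both equivalences.\<close>
  ultimately show ?thesis
    unfolding loc using finite_type_loc_system_of[of "semistar_Inter A st"] by blast
qed

end
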